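(* Let $\alpha,\beta$ be positive real numbers with $\alpha(e-1)+\beta e\ge e$. Let $f\in\mathcal{H}$ be such that $zf'(z)/f(z)$ is analytic in $\mathbb{D}$. If $$\left((1-\alpha)+(\alpha-\beta)\frac{zf'(z)}{f(z)}\right)\frac{zf'(z)}{f(z)}+\beta\frac{zf'(z)}{f(z)}\left(1+\frac{zf''(z)}{f'(z)}\right)\prec 1+z,$$ then $f\in\mathcal{S}^*_e$.
   Context: $\mathbb{D}=\{z\in\mathbb{C}:|z|<1\}$. $\mathcal{H}$ is the class of analytic functions $f$ on $\mathbb{D}$ with $f(0)=0$ and $f'(0)=1$. For functions $F,G$ analytic in $\mathbb{D}$, $F\prec G$ means there is an analytic $w:\mathbb{D}\to\mathbb{C}$ with $w(0)=0$, $|w(z)|<1$ and $F(z)=G(w(z))$ for all $z\in\mathbb{D}$; writing $F\prec G$ presupposes that $F$ and $G$ are analytic in $\mathbb{D}$ (removable singularities being filled in; in particular $zf'(z)/f(z)$ takes the value $1$ at $z=0$). $\mathcal{S}^*_e$ is the class of $f\in\mathcal{H}$ with $zf'(z)/f(z)\prec e^z$. *)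

theory Defs
  imports "HOL-Complex_Analysis.Complex_Analysis"
begin

definition class_H :: "(complex \<Rightarrow> complex) set" where
  "class_H = {f. f holomorphic_on ball 0 1 \<and> f 0 = 0 \<and> deriv f 0 = 1}"

definition subordinate :: "(complex \<Rightarrow> complex) \<Rightarrow> (complex \<Rightarrow> complex) \<Rightarrow> bool"
    (infix "\<prec>\<^sub>s" 50) where
  "F \<prec>\<^sub>s G \<longleftrightarrow>
     F holomorphic_on ball 0 1 \<and> G holomorphic_on ball 0 1 \<and>
     (\<exists>w. w holomorphic_on ball 0 1 \<and> w 0 = 0 \<and>
          (\<forall>z\<in>ball 0 1. norm (w z) < 1) \<and>
          (\<forall>z\<in>ball 0 1. F z = G (w z)))"

(* Division by zero yields 0 in HOL, so quotients such as z f'(z) / f(z) carry spurious values at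
   the zeros of their denominators (for instance 0 instead of 1 at z = 0). The operator remove_sings
   replaces the value at every point by the limit there, i.e. it fills in the removable
   singularities. At a pole it returns 0, so the filled-in function is still discontinuous there
   and holomorphic_on excludes poles. *)

definition starlike_quotient :: "(complex \<Rightarrow> complex) \<Rightarrow> complex \<Rightarrow> complex" where
  "starlike_quotient f = remove_sings (\<lambda>z. z * deriv f z / f z)"

definition S_star_e :: "(complex \<Rightarrow> complex) set" where
  "S_star_e = {f \<in> class_H. starlike_quotient f \<prec>\<^sub>s exp}"

end

(* If p = z f'/f leaves exp(D), take a point z0 of minimal modulus where it does. There
   p(z0) = exp(zeta) with |zeta| = 1, and Jack's lemma for w = Ln p gives z0 p'(z0) = m zeta exp(zeta)
   with m >= 1. Since the expression in the hypothesis equals (1 - alpha) p + alpha p^2 + beta z p',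
   it takes the value X + 1 at z0, where
     X = u + alpha u (u - 1) + beta m zeta u - 1,  u = exp(zeta),
   and subordination to 1 + z forces |X| < 1. But |X| >= 1 for every zeta
   on the unit circle. Writing zeta = c + i s with s >= 0, this last inequality is witnessed by
   Re X >= 1 for c near 1, by Im X >= 1 for intermediate c, and by Re X <= -1 otherwise; the condition on alpha, beta is exactly the case zeta = -1, m = 1. *)
theory Submission
  imports Defs
begin

section \<open>Taylor bounds for sine and cosine\<close>

lemma sin_ge_cubic:
  fixes x :: real assumes "0 \<le> x" shows "x - x^3/6 \<le> sin x"
proof -
  obtain t where t: "sin x = (\<Sum>m<3. sin_coeff m * x ^ m) + (sin (t + 1/2 * real 3 * pi) / fact 3) * x ^ 3"
    using Maclaurin_sin_expansion by blast
  have "sin (t + 1/2 * real 3 * pi) * x^3 \<ge> (-1) * x^3"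
    using assms by (intro mult_right_mono) auto
  with t show ?thesis
    by (simp add: numeral_eq_Suc sin_coeff_def field_simps)
qed

lemma cos_le_quartic:
  fixes x :: real shows "cos x \<le> 1 - x^2/2 + x^4/24"
proof -
  obtain t where t: "cos x = (\<Sum>m<4. cos_coeff m * x ^ m) + (cos (t + 1/2 * real 4 * pi) / fact 4) * x ^ 4"
    using Maclaurin_cos_expansion by blast
  have "cos (t + 1/2 * real 4 * pi) / fact 4 * x^4 \<le> 1 / fact 4 * x^4"
    by (intro mult_right_mono divide_right_mono) auto
  moreover have "(\<Sum>m<4. cos_coeff m * x ^ m) = 1 - x^2/2"
  proof -
    have "{..<4::nat} = {0, 1, 2, 3}" by auto
    then show ?thesis by (simp add: cos_coeff_def)
  qed
  ultimately show ?thesis using t by (simp add: fact_numeral)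
qed

lemma cos_ge_quadratic:
  fixes x :: real shows "1 - x^2/2 \<le> cos x"
proof -
  obtain t where t: "cos x = (\<Sum>m<2. cos_coeff m * x ^ m) + (cos (t + 1/2 * real 2 * pi) / fact 2) * x ^ 2"
    using Maclaurin_cos_expansion by blast
  have "cos (t + 1/2 * real 2 * pi) * x^2 \<ge> (-1) * x^2"
    by (intro mult_right_mono) auto
  with t show ?thesis
    by (simp add: numeral_eq_Suc cos_coeff_def field_simps)
qed

section \<open>Real inequalities for a point \<open>c + i s\<close> of the upper unit
  semicircle\<close>

text \<open>Bounds the coefficient of \<alpha> in the real part, with equality at
  \<open>c = -1\<close>. If \<open>cos (2 * s)\<close> is positive then \<open>c < 0\<close>, so
  \<open>s^2 = (1 + c) * (1 - c)\<close> is at least \<open>1 + c\<close> and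
  \<open>exp (- (1 + c))\<close> is at least \<open>1 - s^2\<close>. What remains is an inequality
  in \<open>s\<close> alone.\<close>

lemma exp_mult_cos_double_le:
  fixes c s :: real
  assumes cs: "c\<^sup>2 + s\<^sup>2 = 1" and s: "0 \<le> s" and c: "c \<le> 27/100"
  shows "exp (1 + c) * cos (2 * s) \<le> cos s"
proof -
  have s2: "s\<^sup>2 \<le> 1" using cs by (smt (verit) zero_le_power2)
  have s4: "s^4 \<le> s\<^sup>2" using s2 mult_left_le[of "s\<^sup>2" "s\<^sup>2"] by (simp add: power4_eq_xxxx power2_eq_square mult.assoc)
  have c0: "cos s \<ge> 0" using cos_ge_quadratic[of s] s2 by simp
  have ub: "cos s \<le> 1 - 11/24 * s\<^sup>2" using cos_le_quartic[of s] s4 by (simp add: field_simps)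
  show ?thesis
  proof (cases "cos (2 * s) \<le> 0")
    case True
    then have "exp (1 + c) * cos (2 * s) \<le> 0" by (simp add: mult_nonneg_nonpos)
    with c0 show ?thesis by simp
  next
    case False
    have cneg: "c < 0"
    proof (rule ccontr)
      assume "\<not> c < 0"
      then have "c\<^sup>2 \<le> (27/100)\<^sup>2" using c by (intro power_mono) auto
      then have "s\<^sup>2 \<ge> 9/10" using cs by (simp add: power2_eq_square)
      moreover have "cos (2 * s) \<le> 1 - 2 * s\<^sup>2 + 2/3 * s^4"
        using cos_le_quartic[of "2 * s"] by (simp add: power_mult_distrib)
      ultimately show False using False s4 by simp
    qed
    have "s\<^sup>2 \<ge> 1 + c"
    proof -
      have "s\<^sup>2 = (1 + c) * (1 - c)" using cs by (simp add: power2_eq_square algebra_simps)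
      moreover have "1 + c \<ge> 0" using cs abs_square_le_1[of c] by (smt (verit) zero_le_power2)
      ultimately show ?thesis using cneg mult_left_mono[of 1 "1 - c" "1 + c"] by simp
    qed
    then have ex: "1 - s\<^sup>2 \<le> exp (- (1 + c))"
      using exp_ge_add_one_self[of "-(1+c)"] by linarith
    \<comment> \<open>With \<open>C = cos s\<close> this reads
      \<open>s^2 * C \<le> (1 - C) * (1 + 2 * C)\<close>, and \<open>1 - C\<close> is at least
      \<open>11/24 * s^2\<close>, where 11/24 = 1/2 - 1/24.\<close>
    have "cos (2 * s) \<le> (1 - s\<^sup>2) * cos s"
    proof -
      have "11/24 * s\<^sup>2 * (1 + 2 * cos s) \<le> (1 - cos s) * (1 + 2 * cos s)"
        using ub c0 by (intro mult_right_mono) auto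
      moreover have "s\<^sup>2 * cos s \<le> s\<^sup>2 * (11/24 * (1 + 2 * cos s))"
      proof (intro mult_left_mono)
        show "cos s \<le> 11/24 * (1 + 2 * cos s)" using cos_le_one[of s] by argo
      qed simp
      moreover have "(1 - cos s) * (1 + 2 * cos s) = 1 + cos s - 2 * (cos s)\<^sup>2"
        "(1 - s\<^sup>2) * cos s = cos s - s\<^sup>2 * cos s"
        "11/24 * s\<^sup>2 * (1 + 2 * cos s) = s\<^sup>2 * (11/24 * (1 + 2 * cos s))"
        by (simp_all add: algebra_simps power2_eq_square)
      ultimately show ?thesis
        unfolding cos_double_cos by linarith
    qed
    also have "\<dots> \<le> exp (- (1 + c)) * cos s"
      using ex c0 by (rule mult_right_mono)
    finally have "exp (1 + c) * cos (2 * s) \<le> exp (1 + c) * (exp (-(1+c)) * cos s)"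
      by simp
    also have "\<dots> = cos s" by (simp flip: mult.assoc exp_add)
    finally show ?thesis .
  qed
qed

text \<open>Bounds the coefficient of \<beta> in the real part, again with equality at
  \<open>c = -1\<close>. Multiplying by \<open>s\<close> and writing
  \<open>s^2 = (1 + c) * (1 - c)\<close> leaves \<open>s * cos s \<le> (1 - c) * sin s\<close> times
  the nonnegative factor \<open>1 + c\<close>; the cubic bound for sine then reduces this to a bound
  on \<open>cos s\<close>.\<close>

lemma cos_add_one_mult_le:
  fixes c s :: real
  assumes cs: "c\<^sup>2 + s\<^sup>2 = 1" and s: "0 \<le> s" and c: "c \<le> 27/100"
  shows "(1 + c) * cos s \<le> s * sin s"
proof (cases "s = 0")
  case True
  then have "c = -1" using cs c by (auto simp: power2_eq_1_iff)
  with True show ?thesis by simp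
next
  case False
  have s2: "s\<^sup>2 \<le> 1" using cs by (smt (verit) zero_le_power2)
  have s4: "s^4 \<le> s\<^sup>2" using s2 mult_left_le[of "s\<^sup>2" "s\<^sup>2"] by (simp add: power4_eq_xxxx power2_eq_square mult.assoc)
  have c1: "1 + c \<ge> 0" using cs abs_square_le_1[of c] by (smt (verit) zero_le_power2)
  have "cos s \<le> (1 - c) * (1 - s\<^sup>2/6)"
  proof (cases "c \<le> 0")
    case True
    have "cos s \<le> 1 * (1 - s\<^sup>2/6)"
      using cos_le_quartic[of s] s4 zero_le_power2[of s] by argo
    also have "\<dots> \<le> (1 - c) * (1 - s\<^sup>2/6)"
      using True s2 by (intro mult_right_mono) auto
    finally show ?thesis .
  next
    case False
    have "cos s \<le> 1 - 11/24 * s\<^sup>2" using cos_le_quartic[of s] s4 by simp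
    also have "\<dots> = 13/24 + 11/24 * c\<^sup>2" using cs by (simp add: field_simps)
    also have "\<dots> \<le> (1 - c) * (5 + c\<^sup>2)/6"
    proof -
      have "c * c \<le> 27/100 * c" using c False by (intro mult_right_mono) auto
      moreover have "c * (c * c) \<le> 1/10 * c" using c False mult_mono[of c "27/100" c "27/100"]
        mult_left_mono[of "c*c" "1/10" c] by simp
      ultimately show ?thesis using c by (simp add: power2_eq_square algebra_simps)
    qed
    also have "(1 - c) * (5 + c\<^sup>2)/6 = (1 - c) * ((5 + c\<^sup>2)/6)" by simp
    also have "(5 + c\<^sup>2)/6 = 1 - s\<^sup>2/6" using cs by argo
    finally show ?thesis .
  qed
  then have "s * cos s \<le> s * ((1 - c) * (1 - s\<^sup>2/6))"
    using s by (rule mult_left_mono)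
  also have "\<dots> = (1 - c) * (s - s^3/6)"
    by (simp add: algebra_simps power2_eq_square power3_eq_cube)
  also have "\<dots> \<le> (1 - c) * sin s"
    using sin_ge_cubic[OF s] c by (intro mult_left_mono) auto
  finally have "(1 + c) * (s * cos s) \<le> (1 + c) * ((1 - c) * sin s)"
    using c1 by (rule mult_left_mono)
  also have "\<dots> = (1 - c\<^sup>2) * sin s" by (simp add: algebra_simps power2_eq_square)
  also have "1 - c\<^sup>2 = s\<^sup>2" using cs by simp
  finally have "s * ((1 + c) * cos s) \<le> s * (s * sin s)"
    by (simp add: algebra_simps power2_eq_square)
  with False s show ?thesis by simp
qed

lemma exp_mult_sin_ge_1:
  fixes c s :: real
  assumes cs: "c\<^sup>2 + s\<^sup>2 = 1" and s: "0 \<le> s" and c: "27/100 \<le> c" "c \<le> 88/100"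
  shows "1 \<le> exp c * sin s"
proof -
  have s2: "s\<^sup>2 = 1 - c\<^sup>2" using cs by simp
  define A where "A = (1 + c + c\<^sup>2/2) * (5 + c\<^sup>2)"
  have A0: "A \<ge> 0" unfolding A_def using c by simp
  have "c * c \<le> 115/100 * c - 2376/10000"
  proof -
    have "0 \<le> (c - 27/100) * (88/100 - c)" using c by simp
    also have "\<dots> = 115/100 * c - 2376/10000 - c * c" by (simp add: field_simps)
    finally show ?thesis by linarith
  qed
  \<comment> \<open>The line runs just below the circular arc at both ends \<open>c = 27/100\<close>
    and \<open>c = 88/100\<close>; the quadratic bound on \<open>c * c\<close> is what carries this
    to the points between.\<close>
  then have "(1178/1000 - 8/10 * c)\<^sup>2 \<le> s\<^sup>2"
    unfolding s2 using c by (simp add: power2_eq_square algebra_simps)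
  then have chord: "1178/1000 - 8/10 * c \<le> s"
    using s by (rule power2_le_imp_le)
  \<comment> \<open>\<open>A\<close> comes from the Taylor polynomials of exp and sin; the square root \<open>s\<close> of \<open>1 - c\<^sup>2\<close> is
    replaced by a chord below it, so that a polynomial inequality in \<open>c\<close> remains.\<close>
  have "6 \<le> (5 + 5 * c + 7/2 * c^2 + c^3) * (1178/1000 - 8/10 * c)"
  proof -
    have expand: "(5 + 5 * c + 7/2 * c^2 + c^3) * (1178/1000 - 8/10 * c)
        = 589/100 + 189/100 * c + 123/1000 * c^2 - 1622/1000 * c^3 - 8/10 * c^4"
      by (simp add: field_simps eval_nat_numeral)
    show ?thesis
    \<comment> \<open>All powers of \<open>c\<close> are replaced by multiples of \<open>c\<close>,
      using the ends of the range; over the whole interval this loses too much, so it is cut in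
      two.\<close>
    proof (cases "c \<le> 7/10")
      case True
      have "c^3 \<le> 49/100 * c" "c^4 \<le> 343/1000 * c"
        using power_mono[OF True, of 2] power_mono[OF True, of 3] c
          mult_right_mono[of "c^2" "(7/10)^2" c] mult_right_mono[of "c^3" "(7/10)^3" c]
        by (simp_all add: eval_nat_numeral mult.assoc)
      moreover have "27/100 * c \<le> c^2"
        using mult_right_mono[of "27/100" c c] c by (simp add: power2_eq_square)
      ultimately show ?thesis using c unfolding expand by linarith
    next
      case False
      have "c^3 \<le> 7744/10000 * c" "c^4 \<le> 681472/1000000 * c" "7/10 * c \<le> c^2"
        using power_mono[OF c(2), of 2] power_mono[OF c(2), of 3] c False
          mult_right_mono[of "c^2" "(88/100)^2" c] mult_right_mono[of "c^3" "(88/100)^3" c]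
          mult_right_mono[of "7/10" c c]
        by (simp_all add: eval_nat_numeral mult.assoc)
      then show ?thesis using c False unfolding expand by linarith
    qed
  qed
  also have "\<dots> \<le> A * s"
  proof (rule mult_mono)
    show "5 + 5 * c + 7/2 * c^2 + c^3 \<le> A"
    proof -
      have "A = 5 + 5 * c + 7/2 * c^2 + c^3 + c^4/2"
        unfolding A_def by (simp add: field_simps eval_nat_numeral)
      then show ?thesis by simp
    qed
  qed (use chord A0 c in auto)
  also have "A * s = 6 * ((1 + c + c\<^sup>2/2) * (s - s^3/6))"
  proof -
    have "s - s^3/6 = s * (1 - s\<^sup>2/6)" by (simp add: algebra_simps power2_eq_square power3_eq_cube)
    also have "1 - s\<^sup>2/6 = (5 + c\<^sup>2)/6" using cs by (simp add: field_simps)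
    finally show ?thesis unfolding A_def by (simp add: mult.commute)
  qed
  also have "\<dots> \<le> 6 * (exp c * sin s)"
  proof -
    have "(1 + c + c\<^sup>2/2) * (s - s^3/6) \<le> (1 + c + c\<^sup>2/2) * sin s"
      using sin_ge_cubic[OF s] c by (intro mult_left_mono) auto
    also have "\<dots> \<le> exp c * sin s"
    proof (intro mult_right_mono)
      show "1 + c + c\<^sup>2/2 \<le> exp c" using exp_lower_Taylor_quadratic[of c] c by simp
      have "s \<le> 1" using s2 s by (smt (verit) power_le_one_iff zero_le_power2 one_power2 power2_le_imp_le)
      then show "0 \<le> sin s" using s pi_gt3 by (intro sin_ge_zero) auto
    qed
    finally show ?thesis by simp
  qed
  finally show ?thesis by simp
qed

section \<open>The boundary inequality on the unit circle\<close>

text \<open>Here \<open>b\<close> stands for \<open>\<beta> * m\<close>, and \<open>ab\<close> is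
  the condition on \<alpha> and \<beta> divided by e, with the factor \<open>m \<ge> 1\<close>
  allowed for.\<close>

lemma norm_exp_symbol_ge_1_upper:
  fixes a b :: real and \<zeta> :: complex
  assumes norm1: "norm \<zeta> = 1" and im: "0 \<le> Im \<zeta>" and a: "0 \<le> a" and b: "0 \<le> b"
    and ab: "1 \<le> a * (1 - exp (-1)) + b"
  shows "1 \<le> norm (exp \<zeta> + of_real a * (exp \<zeta> * (exp \<zeta> - 1)) + of_real b * (\<zeta> * exp \<zeta>) - 1)"
    (is "1 \<le> norm ?X")
proof -
  define c s where "c = Re \<zeta>" and "s = Im \<zeta>"
  define E where "E = exp c"
  have s0: "0 \<le> s" using im by (simp add: s_def)
  have E0: "E > 0" by (simp add: E_def)
  have cs: "c\<^sup>2 + s\<^sup>2 = 1"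
    using norm1 by (simp add: c_def s_def cmod_def)
  have s2: "s\<^sup>2 \<le> 1" using cs by (smt (verit) zero_le_power2)
  have s1: "s \<le> 1" using s2 s0 by (metis one_power2 power2_le_imp_le zero_le_one)
  have cos0: "cos s \<ge> 1/2" using cos_ge_quadratic[of s] s2 by simp
  have sin0: "sin s \<ge> 0" using s0 s1 pi_gt3 by (intro sin_ge_zero) auto
  have ReX: "Re ?X = E * cos s + a * (E * (E * cos (2 * s) - cos s)) + b * (E * (c * cos s - s * sin s)) - 1"
    unfolding cos_double power2_eq_square
    by (simp add: Re_exp Im_exp c_def s_def E_def algebra_simps)
  have ImX: "Im ?X = E * sin s + a * (E * sin s * (2 * E * cos s - 1)) + b * (E * (s * cos s + c * sin s))"
    by (simp add: Re_exp Im_exp c_def s_def E_def algebra_simps)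
  consider "c \<le> 27/100" | "27/100 \<le> c" "c \<le> 88/100" | "88/100 \<le> c" by linarith
  then show ?thesis
  proof cases
    case 1
    \<comment> \<open>\<open>A\<close> and \<open>B\<close> bound the coefficients of
      \<open>b\<close> and \<open>a\<close> by negative multiples of \<open>cos s\<close>, so
      \<open>ab\<close> outweighs the leading \<open>cos s\<close> and the real part is at most
      -1.\<close>
    have A: "c * cos s - s * sin s \<le> - cos s"
      using cos_add_one_mult_le[OF cs s0 1] by (simp add: algebra_simps)
    have "exp 1 * (E * cos (2 * s)) \<le> cos s"
      using exp_mult_cos_double_le[OF cs s0 1] by (simp add: E_def exp_add mult.assoc)
    then have B: "E * cos (2 * s) - cos s \<le> - ((1 - exp (-1)) * cos s)"
      by (simp add: exp_minus field_simps)
    have "cos s + a * (E * cos (2 * s) - cos s) + b * (c * cos s - s * sin s)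
      \<le> cos s + a * (- ((1 - exp (-1)) * cos s)) + b * (- cos s)"
      using A B a b by (intro add_mono mult_left_mono) auto
    also have "\<dots> = (1 - (a * (1 - exp (-1)) + b)) * cos s" by (simp add: algebra_simps)
    also have "\<dots> \<le> 0" using ab cos0 by (intro mult_nonpos_nonneg) auto
    finally have "E * (cos s + a * (E * cos (2 * s) - cos s) + b * (c * cos s - s * sin s)) \<le> 0"
      using E0 by (intro mult_nonneg_nonpos) auto
    also have "E * (cos s + a * (E * cos (2 * s) - cos s) + b * (c * cos s - s * sin s)) = Re ?X + 1"
      unfolding ReX by (simp add: algebra_simps)
    finally have "1 \<le> \<bar>Re ?X\<bar>" by linarith
    then show ?thesis using abs_Re_le_cmod order_trans by blast
  next
    case 2
    \<comment> \<open>The contributions of \<open>a\<close> and \<open>b\<close> to the imaginary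
      part are nonnegative, which leaves \<open>E * sin s\<close>.\<close>
    have "E \<ge> 1" using 2 by (simp add: E_def)
    then have "1 * (1/2) \<le> E * cos s" using cos0 by (intro mult_mono) auto
    then have "0 \<le> a * (E * sin s * (2 * E * cos s - 1))"
      using a E0 sin0 by (intro mult_nonneg_nonneg) auto
    moreover have "0 \<le> b * (E * (s * cos s + c * sin s))"
      using b E0 sin0 s0 cos0 2 by (intro mult_nonneg_nonneg add_nonneg_nonneg) auto
    moreover have "1 \<le> E * sin s" using exp_mult_sin_ge_1[OF cs s0 2] by (simp add: E_def)
    ultimately have "1 \<le> \<bar>Im ?X\<bar>" unfolding ImX by linarith
    then show ?thesis using abs_Im_le_cmod order_trans by blast
  next
    case 3
    have "(88/100)\<^sup>2 \<le> c\<^sup>2" using 3 by (intro power_mono) auto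
    then have c2: "c\<^sup>2 \<ge> 7744/10000" by (simp add: power2_eq_square)
    have E: "E \<ge> 22672/10000"
      using exp_lower_Taylor_quadratic[of c] 3 c2 by (simp add: E_def)
    have cosl: "cos s \<ge> 8872/10000" using cos_ge_quadratic[of s] cs c2 by argo
    have "cos (2 * s) \<ge> 1 - 2 * s\<^sup>2"
      using cos_ge_quadratic[of "2 * s"] by (simp add: power_mult_distrib)
    then have "cos (2 * s) \<ge> 54/100" using cs c2 by argo
    then have "22672/10000 * (54/100) \<le> E * cos (2 * s)" using E by (intro mult_mono) auto
    then have "E * cos (2 * s) - cos s \<ge> 0" using cos_le_one[of s] by argo
    then have "0 \<le> a * (E * (E * cos (2 * s) - cos s))"
      using a E0 by (intro mult_nonneg_nonneg) auto
    moreover have "0 \<le> c * cos s - s * sin s"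
    proof -
      have "88/100 * (8872/10000) \<le> c * cos s" using 3 cosl by (intro mult_mono) auto
      moreover have "s * sin s \<le> s * s" using sin_x_le_x s0 by (intro mult_left_mono) auto
      ultimately show ?thesis using cs c2 unfolding power2_eq_square by argo
    qed
    then have "0 \<le> b * (E * (c * cos s - s * sin s))"
      using b E0 by (intro mult_nonneg_nonneg) auto
    \<comment> \<open>The product on the left exceeds 2, so the real part is still at least 1 after
      the final subtraction of 1.\<close>
    moreover have "22672/10000 * (8872/10000) \<le> E * cos s" using E cosl by (intro mult_mono) auto
    ultimately have "1 \<le> \<bar>Re ?X\<bar>" unfolding ReX by argo
    then show ?thesis using abs_Re_le_cmod order_trans by blast
  qed
qed

text \<open>As \<open>a\<close> and \<open>b\<close> are real, conjugating \<zeta> conjugates the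
  expression and keeps its norm.\<close>

lemma norm_exp_symbol_ge_1:
  fixes a b :: real and \<zeta> :: complex
  assumes "norm \<zeta> = 1" "0 \<le> a" "0 \<le> b" "1 \<le> a * (1 - exp (-1)) + b"
  shows "1 \<le> norm (exp \<zeta> + of_real a * (exp \<zeta> * (exp \<zeta> - 1)) + of_real b * (\<zeta> * exp \<zeta>) - 1)"
    (is "1 \<le> norm (?X \<zeta>)")
proof (cases "0 \<le> Im \<zeta>")
  case True
  then show ?thesis using norm_exp_symbol_ge_1_upper assms by blast
next
  case False
  have "1 \<le> norm (?X (cnj \<zeta>))"
    using norm_exp_symbol_ge_1_upper[of "cnj \<zeta>" a b] assms False by simp
  also have "?X (cnj \<zeta>) = cnj (?X \<zeta>)"
    by (simp add: exp_cnj)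
  finally show ?thesis by (simp only: complex_mod_cnj)
qed

section \<open>Jack's lemma and the first contact with the boundary of the exponential image\<close>

text \<open>The Schwarz lemma gives \<open>norm (w z) \<le> norm z / r\<close>. In the coordinate
  \<open>z = z0 * exp x\<close> the disc becomes the half-plane \<open>Re x \<le> 0\<close>, on
  which the normalised quotient \<open>g\<close> has real part at most \<open>1 = g 0\<close>. Hence
  its derivative at 0 has nonpositive real part along every direction into that half-plane.\<close>

lemma Jack_lemma:
  fixes w :: "complex \<Rightarrow> complex"
  assumes r: "0 < r" and holw: "w holomorphic_on ball 0 r" and w0: "w 0 = 0"
    and lt1: "\<And>z. norm z < r \<Longrightarrow> norm (w z) < 1"
    and le1: "\<And>z. norm z = r \<Longrightarrow> norm (w z) \<le> 1"
    and z0: "norm z0 = r" and wz0: "norm (w z0) = 1"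
    and der: "(w has_field_derivative d) (at z0)"
  obtains m :: real where "1 \<le> m" "z0 * d = of_real m * w z0"
proof -
  have bound: "norm (w z) \<le> norm z / r" if "norm z \<le> r" for z
  proof (cases "norm z = r")
    case True
    then show ?thesis using le1[of z] r by simp
  next
    case False
    define h where "h = (\<lambda>x. w (of_real r * x))"
    have "norm (h (z / of_real r)) \<le> norm (z / of_real r)"
    proof (rule Schwarz_Lemma(1))
      show "h holomorphic_on ball 0 1"
        unfolding h_def
      proof (rule holomorphic_on_compose_gen[unfolded o_def, OF _ holw])
        show "(\<lambda>x. of_real r * x) ` ball 0 1 \<subseteq> ball (0::complex) r"
          using r by (auto simp: norm_mult)
      qed (intro holomorphic_intros)
      show "norm (h x) < 1" if "norm x < 1" for x
        using that r by (auto simp: h_def norm_mult intro: lt1)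
    qed (use r w0 that False in \<open>auto simp: h_def norm_divide\<close>)
    then show ?thesis using r by (simp add: h_def norm_divide)
  qed
  define A where "A = cnj (w z0) * (z0 * d)"
  define g where "g = (\<lambda>x. cnj (w z0) * w (z0 * exp x) * exp (- x))"
  have ww: "cnj (w z0) * w z0 = 1"
    using wz0 by (simp add: complex_norm_square[symmetric] mult.commute)
  have derg: "(g has_field_derivative (A - 1)) (at 0)"
  proof -
    have "((\<lambda>x. z0 * exp x) has_field_derivative z0) (at 0)"
      by (auto intro!: derivative_eq_intros)
    then have "((\<lambda>x. w (z0 * exp x)) has_field_derivative d * z0) (at 0)"
      using der by (intro DERIV_chain2[where f = w]) auto
    then have "(g has_field_derivative cnj (w z0) * (d * z0) - cnj (w z0) * w z0) (at 0)"
      unfolding g_def by (auto intro!: derivative_eq_intros)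
    then show ?thesis by (simp only: ww A_def mult.commute[of d])
  qed
  have dir: "Re ((A - 1) * v) \<le> 0" if v: "Re v \<le> 0" for v
  proof (rule ccontr)
    assume "\<not> Re ((A - 1) * v) \<le> 0"
    then have pos: "0 < Re ((A - 1) * v)" by simp
    have "((\<lambda>t. of_real t * v) has_vector_derivative v) (at 0)"
      by (auto intro!: derivative_eq_intros)
    then have "((g \<circ> (\<lambda>t. of_real t * v)) has_vector_derivative v * (A - 1)) (at 0)"
      using derg by (intro field_vector_diff_chain_at) auto
    then have "((\<lambda>t. Re (g (of_real t * v))) has_field_derivative Re ((A - 1) * v)) (at 0)"
      using has_field_derivative_Re by (fastforce simp: o_def mult.commute)
    from DERIV_pos_inc_right[OF this pos] obtain e where
      e: "e > 0" "\<And>h. h > 0 \<Longrightarrow> h < e \<Longrightarrow> Re (g 0) < Re (g (of_real h * v))" by auto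
    define h where "h = e / 2"
    have h: "h > 0" "h < e" using e(1) by (auto simp: h_def)
    have nz: "norm (z0 * exp (of_real h * v)) = r * exp (h * Re v)"
      by (simp add: norm_mult z0)
    also have "\<dots> \<le> r" using r h v by (simp add: mult_nonneg_nonpos)
    finally have "norm (w (z0 * exp (of_real h * v))) \<le> exp (h * Re v)"
      using bound r nz by fastforce
    then have "norm (g (of_real h * v)) \<le> exp (h * Re v) * exp (- (h * Re v))"
      unfolding g_def by (simp add: norm_mult wz0)
    then have "Re (g (of_real h * v)) \<le> 1"
      using complex_Re_le_cmod[of "g (of_real h * v)"] by (simp flip: exp_add)
    moreover have "Re (g 0) = 1" by (simp add: g_def ww)
    ultimately show False using e(2)[OF h] by simp
  qed
  \<comment> \<open>Both tangential directions are admissible, so \<open>A\<close> is real; the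
    inward direction -1 then gives \<open>A \<ge> 1\<close>, and \<open>A\<close> is the wanted
    \<open>m\<close>.\<close>
  have "Im A = 0" using dir[of \<i>] dir[of "- \<i>"] by simp
  moreover have "1 \<le> Re A" using dir[of "-1"] by simp
  moreover have "z0 * d = A * w z0"
    using ww by (simp add: A_def mult_ac)
  ultimately show thesis using that[of "Re A"] by (simp add: complex_eq_iff)
qed

lemma Ln_exp_cball_1:
  fixes \<zeta> :: complex
  assumes "norm \<zeta> \<le> 1"
  shows "Ln (exp \<zeta>) = \<zeta>"
  using order_trans[OF abs_Im_le_cmod assms] pi_gt3 by (intro Ln_exp) auto

text \<open>Since 1 < pi/2, the exponential maps the closed unit disc into the right half-plane,
  away from the branch cut of \<open>Ln\<close>.\<close>

lemma exp_cball_1: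
  assumes "u \<in> exp ` cball (0::complex) 1"
  shows "norm (Ln u) \<le> 1" "exp (Ln u) = u" "u \<notin> \<real>\<^sub>\<le>\<^sub>0"
proof -
  obtain \<zeta> where \<zeta>: "u = exp \<zeta>" "norm \<zeta> \<le> 1" using assms by auto
  then show "norm (Ln u) \<le> 1" "exp (Ln u) = u" using Ln_exp_cball_1 by auto
  have "cos (Im \<zeta>) > 0"
    using order_trans[OF abs_Im_le_cmod \<zeta>(2)] pi_gt3 by (intro cos_gt_zero_pi) auto
  then show "u \<notin> \<real>\<^sub>\<le>\<^sub>0" by (simp add: \<zeta> Re_exp complex_nonpos_Reals_iff not_le)
qed

lemma exp_ball_1:
  assumes "u \<in> exp ` ball (0::complex) 1"
  shows "norm (Ln u) < 1"
  using assms Ln_exp_cball_1 by fastforce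

lemma exp_contact_point:
  fixes p :: "complex \<Rightarrow> complex"
  assumes holp: "p holomorphic_on ball 0 1" and p0: "p 0 = 1"
    and z1: "z1 \<in> ball 0 1" "p z1 \<notin> exp ` ball 0 1"
  obtains z0 \<zeta> and m :: real where "z0 \<in> ball 0 1" "norm \<zeta> = 1" "1 \<le> m" "p z0 = exp \<zeta>"
    "z0 * deriv p z0 = of_real m * (\<zeta> * exp \<zeta>)"
proof -
  have contp: "continuous_on (ball 0 1) p" using holp by (rule holomorphic_on_imp_continuous_on)
  have openE: "open (exp ` ball (0::complex) 1)"
    by (rule open_mapping_thm3) (use pi_gt3 in \<open>auto intro!: holomorphic_intros inj_on_subset[OF inj_on_exp_pi[of 0]]\<close>)
  \<comment> \<open>\<open>K\<close> is compact because \<open>exp\<close> is injective on the disc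
    and so has an open image; the minimal modulus is therefore attained.\<close>
  define K where "K = cball 0 (norm z1) \<inter> p -` (- exp ` ball 0 1)"
  have "closed K" unfolding K_def
    by (rule continuous_closed_preimage)
      (use z1 openE in \<open>auto intro: continuous_on_subset[OF contp]\<close>)
  then have "compact K" unfolding K_def
    by (metis Int_absorb2 closed_Int_compact compact_cball inf_le1)
  moreover have "z1 \<in> K" using z1 by (simp add: K_def)
  ultimately obtain z0 where z0: "z0 \<in> K" "\<And>z. z \<in> K \<Longrightarrow> norm z0 \<le> norm z"
    using continuous_attains_inf[of K norm] by (auto intro: continuous_intros)
  define r where "r = norm z0"
  have r1: "r < 1" using z0(1) z1 by (auto simp: r_def K_def)
  have pz0: "p z0 \<notin> exp ` ball 0 1" using z0(1) by (simp add: K_def)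
  have "p 0 \<in> exp ` ball 0 1" unfolding p0 using exp_zero by (metis centre_in_ball image_eqI zero_less_one)
  then have r0: "r > 0" using pz0 by (auto simp: r_def)
  have inner: "p z \<in> exp ` ball 0 1" if "norm z < r" for z
    using z0(2)[of z] z0(1) that by (auto simp: r_def K_def)
  \<comment> \<open>Continuity carries the inclusion to the circle of radius \<open>r\<close>, so
    \<open>Ln (p z)\<close> is well behaved there too, in particular at \<open>z0\<close>.\<close>
  have closed: "p z \<in> exp ` cball 0 1" if "norm z \<le> r" for z
  proof -
    have "p ` closure (ball 0 r) \<subseteq> exp ` cball 0 1"
    proof (rule image_closure_subset)
      show "continuous_on (closure (ball 0 r)) p"
        using r0 r1 by (intro continuous_on_subset[OF contp]) auto
      show "closed (exp ` cball (0::complex) 1)"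
        by (intro compact_imp_closed compact_continuous_image continuous_intros) auto
      show "p ` ball 0 r \<subseteq> exp ` cball 0 1" using inner by fastforce
    qed
    then show ?thesis using that r0 by auto
  qed
  define w where "w = (\<lambda>z. Ln (p z))"
  have exp_w: "exp (w z) = p z" if "norm z \<le> r" for z
    unfolding w_def using exp_cball_1(2)[OF closed[OF that]] .
  have wle: "norm (w z) \<le> 1" if "norm z \<le> r" for z
    unfolding w_def using exp_cball_1(1)[OF closed[OF that]] .
  have nonpos: "p z \<notin> \<real>\<^sub>\<le>\<^sub>0" if "norm z \<le> r" for z
    using exp_cball_1(3)[OF closed[OF that]] .
  have wz0: "norm (w z0) = 1"
  proof -
    have "\<not> norm (w z0) < 1" using pz0 exp_w[of z0] by (force simp: r_def)
    then show ?thesis using wle[of z0] by (simp add: r_def)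
  qed
  have derp: "(p has_field_derivative deriv p z0) (at z0)"
    using holp r1 by (intro holomorphic_derivI[of _ "ball 0 1"]) (auto simp: r_def)
  have derw: "(w has_field_derivative deriv p z0 / p z0) (at z0)"
    unfolding w_def using nonpos[of z0]
    by (auto intro!: derivative_eq_intros derp simp: r_def divide_inverse mult.commute)
  obtain m where m: "1 \<le> m" "z0 * (deriv p z0 / p z0) = of_real m * w z0"
  proof (rule Jack_lemma[OF r0 _ _ _ _ _ wz0 derw])
    show "w holomorphic_on ball 0 r" unfolding w_def
      using nonpos r1 by (intro holomorphic_intros holomorphic_on_subset[OF holp]) auto
    show "w 0 = 0" by (simp add: w_def p0)
    show "norm (w z) < 1" if "norm z < r" for z
      unfolding w_def using exp_ball_1[OF inner[OF that]] .
  qed (auto simp: r_def wle)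
  show thesis
  proof (rule that[of z0 "w z0" m])
    show "p z0 = exp (w z0)" using exp_w[of z0] by (simp add: r_def)
    then show "z0 * deriv p z0 = of_real m * (w z0 * exp (w z0))"
      using m(2) by (simp add: field_simps)
  qed (use r1 m wz0 in \<open>auto simp: r_def\<close>)
qed

text \<open>The Schwarz function is \<open>Ln (p z)\<close>, as \<open>Ln\<close> inverts
  \<open>exp\<close> holomorphically on the image of the disc.\<close>

lemma subordinate_expI:
  assumes holp: "p holomorphic_on ball 0 1" and p0: "p 0 = 1"
    and sub: "p ` ball 0 1 \<subseteq> exp ` ball 0 1"
  shows "p \<prec>\<^sub>s exp"
  unfolding subordinate_def
proof (intro conjI exI[of _ "\<lambda>z. Ln (p z)"] ballI)
  have ball: "p z \<in> exp ` ball 0 1" if "z \<in> ball 0 1" for z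
    using sub that by blast
  then have cball: "p z \<in> exp ` cball 0 1" if "z \<in> ball 0 1" for z
    using that ball_subset_cball by blast
  show "(\<lambda>z. Ln (p z)) holomorphic_on ball 0 1"
    using exp_cball_1(3)[OF cball] by (intro holomorphic_intros holp)
  show "norm (Ln (p z)) < 1" if "z \<in> ball 0 1" for z
    using exp_ball_1[OF ball[OF that]] .
  show "p z = exp (Ln (p z))" if "z \<in> ball 0 1" for z
    using exp_cball_1(2)[OF cball[OF that]] by simp
qed (use holp p0 in \<open>auto intro: holomorphic_intros\<close>)

section \<open>The quotient \<open>z * deriv f z / f z\<close> and its removable
  singularities\<close>

text \<open>Away from 0 the quotient is \<open>deriv f z / (f z / z)\<close>, whose numerator and
  denominator both tend to 1.\<close>

lemma starlike_quotient_0: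
  assumes "f \<in> class_H"
  shows "starlike_quotient f 0 = 1"
  unfolding starlike_quotient_def
proof (rule remove_sings_eqI)
  have hol: "f holomorphic_on ball 0 1" and f0: "f 0 = 0" and f'0: "deriv f 0 = 1"
    using assms by (auto simp: class_H_def)
  have "(f has_field_derivative 1) (at 0)"
    using holomorphic_derivI[OF hol, of 0] f'0 by simp
  then have "(\<lambda>z. f z / z) \<midarrow>0\<rightarrow> 1" using f0 by (simp add: has_field_derivative_iff)
  moreover have "deriv f \<midarrow>0\<rightarrow> 1"
    using holomorphic_deriv[OF hol] f'0
    by (metis centre_in_ball continuous_on_eq_continuous_at holomorphic_on_imp_continuous_on
        isContD open_ball zero_less_one)
  ultimately have "(\<lambda>z. deriv f z / (f z / z)) \<midarrow>0\<rightarrow> 1 / 1"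
    by (intro tendsto_divide) auto
  then show "(\<lambda>z. z * deriv f z / f z) \<midarrow>0\<rightarrow> 1" by (simp add: mult.commute)
qed

text \<open>The normalisation at 0 keeps \<open>f\<close> and \<open>deriv f\<close> from vanishing
  identically, so their zeros are isolated. Near each point the raw quotients are thus genuine,
  except possibly at the point itself.\<close>

lemma class_H_eventually_nonzero:
  assumes f: "f \<in> class_H" and z: "z \<in> ball 0 1"
  shows "\<forall>\<^sub>F x in at z. x \<in> ball 0 1 \<and> f x \<noteq> 0 \<and> deriv f x \<noteq> 0"
proof -
  have hol: "f holomorphic_on ball 0 1" and f'0: "deriv f 0 = 1"
    using f by (auto simp: class_H_def)
  obtain x where "x \<in> ball 0 1" "f x \<noteq> 0"
  proof (rule ccontr)
    assume "\<not> thesis"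
    then have "\<And>x. x \<in> ball 0 1 \<Longrightarrow> f x = 0" using that by blast
    then have "deriv f 0 = deriv (\<lambda>_. 0) 0"
      by (intro deriv_cong_ev eventually_mono[OF eventually_nhds_in_open[of "ball 0 1"]]) auto
    with f'0 show False by simp
  qed
  then have "\<forall>\<^sub>F x in at z. f x \<noteq> 0 \<and> x \<in> ball 0 1"
    using hol z by (intro non_zero_neighbour_alt) auto
  moreover have "\<forall>\<^sub>F x in at z. deriv f x \<noteq> 0 \<and> x \<in> ball 0 1"
    using hol z f'0 by (intro non_zero_neighbour_alt[where \<beta> = 0] holomorphic_deriv) auto
  ultimately show ?thesis by eventually_elim auto
qed

text \<open>Logarithmic differentiation of \<open>z * deriv f z / f z\<close>; it serves to trade
  the second derivative of \<open>f\<close> for the first derivative of the quotient.\<close>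

lemma starlike_quotient_deriv:
  assumes hol: "f holomorphic_on S" "open S" and z: "z \<in> S" "f z \<noteq> 0" "deriv f z \<noteq> 0"
  defines "q \<equiv> z * deriv f z / f z"
  shows "starlike_quotient f z = q"
    "z * deriv (starlike_quotient f) z = q * (1 + z * deriv (deriv f) z / deriv f z - q)"
proof -
  define U where "U = {x \<in> S. f x \<noteq> 0}"
  have "U = S \<inter> f -` (- {0})" by (auto simp: U_def)
  then have U: "open U"
    using hol by (simp add: continuous_open_preimage holomorphic_on_imp_continuous_on open_Compl)
  have hol_q: "(\<lambda>x. x * deriv f x / f x) holomorphic_on U"
    by (intro holomorphic_intros holomorphic_on_subset[OF hol(1)]
        holomorphic_on_subset[OF holomorphic_deriv[OF hol]]) (auto simp: U_def)
  have eq: "starlike_quotient f x = x * deriv f x / f x" if "x \<in> U" for x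
    unfolding starlike_quotient_def
    using that U hol_q by (intro remove_sings_at_analytic) (auto simp: analytic_at)
  have zU: "z \<in> U" using z by (simp add: U_def)
  show "starlike_quotient f z = q" using eq[OF zU] by (simp add: q_def)
  have d1: "(f has_field_derivative deriv f z) (at z)"
    using hol z by (intro holomorphic_derivI)
  have d2: "(deriv f has_field_derivative deriv (deriv f) z) (at z)"
    using hol z by (intro holomorphic_derivI[OF holomorphic_deriv])
  have "((\<lambda>x. x * deriv f x / f x) has_field_derivative
      ((deriv f z + z * deriv (deriv f) z) * f z - z * deriv f z * deriv f z) / (f z * f z)) (at z)"
    using z by (auto intro!: derivative_eq_intros d1 d2 simp: mult_ac)
  moreover have "deriv (starlike_quotient f) z = deriv (\<lambda>x. x * deriv f x / f x) z"
    using eq by (intro deriv_cong_ev eventually_mono[OF eventually_nhds_in_open[OF U zU]]) auto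
  ultimately have q': "deriv (starlike_quotient f) z =
      ((deriv f z + z * deriv (deriv f) z) * f z - z * deriv f z * deriv f z) / (f z * f z)"
    by (simp add: DERIV_imp_deriv)
  show "z * deriv (starlike_quotient f) z = q * (1 + z * deriv (deriv f) z / deriv f z - q)"
    unfolding q' using z by (simp add: q_def field_simps)
qed

theorem mainTheorem7:
  fixes \<alpha> \<beta> :: real and f :: "complex \<Rightarrow> complex"
  assumes "\<alpha> > 0" and "\<beta> > 0"
    and "\<alpha> * (exp 1 - 1) + \<beta> * exp 1 \<ge> exp 1"
    and "f \<in> class_H"
    and "starlike_quotient f holomorphic_on ball 0 1"
    and "remove_sings (\<lambda>z.
           ((1 - of_real \<alpha>) + (of_real \<alpha> - of_real \<beta>) * (z * deriv f z / f z))
             * (z * deriv f z / f z)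
           + of_real \<beta> * (z * deriv f z / f z)
             * (1 + z * deriv (deriv f) z / deriv f z))
         \<prec>\<^sub>s (\<lambda>z. 1 + z)"
  shows "f \<in> S_star_e"
proof -
  define p where "p = starlike_quotient f"
  define F where "F = (\<lambda>z.
           ((1 - of_real \<alpha>) + (of_real \<alpha> - of_real \<beta>) * (z * deriv f z / f z))
             * (z * deriv f z / f z)
           + of_real \<beta> * (z * deriv f z / f z)
             * (1 + z * deriv (deriv f) z / deriv f z))"
  \<comment> \<open>\<open>H\<close> is the expression of the hypothesis in terms of
    \<open>p\<close>. It is holomorphic on the whole disc and agrees with \<open>F\<close> on
    punctured neighbourhoods, so its values are the limits that \<open>remove_sings\<close> fills
    in.\<close>
  define H where "H = (\<lambda>z. p z + of_real \<alpha> * (p z * (p z - 1)) + of_real \<beta> * (z * deriv p z))"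
  have holp: "p holomorphic_on ball 0 1" using assms(5) by (simp add: p_def)
  have holf: "f holomorphic_on ball 0 1" using assms(4) by (simp add: class_H_def)
  have F_eq: "remove_sings F z = H z" if z: "z \<in> ball 0 1" for z
  proof (rule remove_sings_eqI)
    have "H holomorphic_on ball 0 1"
      unfolding H_def by (intro holomorphic_intros holp holomorphic_deriv) auto
    then have "H \<midarrow>z\<rightarrow> H z"
      using z by (metis continuous_on_eq_continuous_at holomorphic_on_imp_continuous_on isContD open_ball)
    moreover have "\<forall>\<^sub>F x in at z. H x = F x"
      using class_H_eventually_nonzero[OF assms(4) z]
    proof eventually_elim
      case (elim x)
      define q k where "q = x * deriv f x / f x" and "k = 1 + x * deriv (deriv f) x / deriv f x"
      have "p x = q" "x * deriv p x = q * (k - q)"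
        using starlike_quotient_deriv[OF holf open_ball, of x] elim
        by (simp_all add: p_def q_def k_def)
      then have "H x = q + of_real \<alpha> * (q * (q - 1)) + of_real \<beta> * (q * (k - q))"
        by (simp add: H_def)
      also have "\<dots> = ((1 - of_real \<alpha>) + (of_real \<alpha> - of_real \<beta>) * q) * q + of_real \<beta> * q * k"
        by (simp add: algebra_simps)
      finally show "H x = F x" by (simp only: F_def q_def k_def)
    qed
    ultimately show "F \<midarrow>z\<rightarrow> H z" by (rule Lim_transform_eventually)
  qed
  have H_lt: "norm (H z - 1) < 1" if "z \<in> ball 0 1" for z
  proof -
    obtain w where "\<forall>z\<in>ball 0 1. norm (w z) < 1" "\<forall>z\<in>ball 0 1. remove_sings F z = 1 + w z"
      using assms(6) unfolding F_def[symmetric] subordinate_def by blast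
    then have "norm (w z) < 1" "H z = 1 + w z" using that F_eq[OF that] by auto
    then show ?thesis by simp
  qed
  have "p z \<in> exp ` ball 0 1" if z: "z \<in> ball 0 1" for z
  proof (rule ccontr)
    assume "p z \<notin> exp ` ball 0 1"
    then obtain z0 \<zeta> and m :: real
      where z0: "z0 \<in> ball 0 1" and \<zeta>: "norm \<zeta> = 1" and m: "1 \<le> m"
        and p: "p z0 = exp \<zeta>" "z0 * deriv p z0 = of_real m * (\<zeta> * exp \<zeta>)"
      using exp_contact_point[OF holp _ z] starlike_quotient_0[OF assms(4)] p_def by metis
    have "exp 1 * (\<alpha> * (1 - exp (-1)) + \<beta>) = \<alpha> * (exp 1 - exp 1 * exp (-1)) + \<beta> * exp 1"
      by (simp only: algebra_simps)
    also have "exp 1 * exp (-1) = (1::real)" by (simp flip: exp_add)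
    finally have "exp 1 * 1 \<le> exp 1 * (\<alpha> * (1 - exp (-1)) + \<beta>)" using assms(3) by simp
    then have "1 \<le> \<alpha> * (1 - exp (-1)) + \<beta>" by simp
    \<comment> \<open>The multiplier \<open>m\<close> is absorbed into the second coefficient, which
      only strengthens the condition of the boundary inequality.\<close>
    also have "\<beta> \<le> \<beta> * m" using m assms(2) by simp
    finally have "1 \<le> norm (exp \<zeta> + of_real \<alpha> * (exp \<zeta> * (exp \<zeta> - 1)) + of_real (\<beta> * m) * (\<zeta> * exp \<zeta>) - 1)"
      using assms(1,2) \<zeta> m by (intro norm_exp_symbol_ge_1) auto
    also have "\<dots> = norm (H z0 - 1)"
      unfolding H_def p by (simp add: mult.assoc)
    finally show False using H_lt[OF z0] by simp
  qed
  then have "p \<prec>\<^sub>s exp"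
    using holp starlike_quotient_0[OF assms(4)] by (intro subordinate_expI) (auto simp: p_def)
  then show ?thesis using assms(4) by (simp add: S_star_e_def p_def)
qed

end
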